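(* For every $N\ge1$, the finite element (FEM) approximation $\dot x_N=A_Nx_N+B_N\mathcal{I}(t)$, $x_N\in\mathbb{R}^{6N}$, $\mathcal{I}(t)\in\mathbb{R}$, of the linear fully dynamic electromagnetic piezoelectric composite, with $A_N,B_N$ as defined in the context, satisfies Brockett's necessary condition for asymptotic stabilizability through continuous state feedback; that is, the image of the $6N\times(6N+1)$ matrix $\begin{bmatrix}A_N & B_N\end{bmatrix}$ is all of $\mathbb{R}^{6N}$.
   Context: Brockett's necessary condition for a system $\dot x=f(x,u)$, $x\in\mathbb{R}^n$, is that $f(x,u)=y$ is solvable for all $y$ with $\|y\|$ sufficiently small. For a linear system $\dot x=Ax+Bu$ this means $\operatorname{Image}\begin{bmatrix}A&B\end{bmatrix}=\mathbb{R}^n$. Physical constants. Subscripts $p$ and $s$ refer to the piezoelectric layer and to the substrate. $\rho_p,\rho_s>0$ are mass densities, $C_p=C_{11,p}>0$ and $C_s=C_{11,s}>0$ stiffnesses, $\beta,\mu>0$ electromagnetic constants, and $\gamma\in\mathbb{R}$ is the piezoelectric coupling constant. The piezoelectric layer has half-width $g_b>0$ and occupies heights $h_a<h_b$, and $$A_p=2g_b(h_b-h_a),\quad I_p=\tfrac23 g_b(h_b^3-h_a^3),\quad I_0=g_b(h_b^2-h_a^2).$$ $A_s,I_s>0$ are the cross-sectional area and the inertia of the substrate. Set $$\rho_A=\rho_pA_p+\rho_sA_s,\quad \rho_I=\rho_pI_p+\rho_sI_s,\quad \rho_{I_0}=\rho_pI_0,$$ $$C_A=C_pA_p+C_sA_s,\quad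 C_I=C_pI_p+C_sI_s,\quad C_{I_0}=C_{11,p}I_0.$$ With $\Delta=\rho_A\rho_I-\rho_{I_0}^2$, $$a_{41}=\frac{\rho_IC_A-\rho_{I_0}C_{I_0}}{\Delta},\quad a_{42}=\frac{\rho_IC_{I_0}-\rho_{I_0}C_I}{\Delta},\quad a_{46}=\gamma\frac{\rho_IA_p-\rho_{I_0}I_0}{\Delta},$$ $$a_{51}=\frac{\rho_AC_{I_0}-\rho_{I_0}C_A}{\Delta},\quad a_{52}=\frac{\rho_AC_I-\rho_{I_0}C_{I_0}}{\Delta},\quad a_{56}=\gamma\frac{\rho_AI_0-\rho_{I_0}A_p}{\Delta}.$$ Element matrices. Let $h>0$ be the element length. $M_1,K_1,K_2\in\mathbb{R}^{N\times N}$ are tridiagonal: - $M_1=\frac{h}{6}\widehat M$, where $\widehat M$ has all diagonal entries $4$; its sub- and superdiagonal entries equal $1$ in rows $1,\dots,N-2$ and equal $2$ in rows $N-1$ and $N$. - $K_1=\frac12\widehat K_1$, where $\widehat K_1$ has zero diagonal, all subdiagonal entries $1$ and all superdiagonal entries $-1$. - $K_2=\frac1h\widehat K_2$, where $\widehat K_2$ has all diagonal entries $2$ and all sub- and superdiagonal entries $-1$. Also $B_1=\frac{-\beta}{2g_b}(1,1,\dots,1)^T\in\mathbb{R}^N$. System. In $N\times N$ blocks, $$A_N=\begin{bmatrix} 0&0&0&I_N&0&0 \\ 0&0&0&0&I_N&0 \\ 0&0&0&0&0&I_N \\ -a_{41}M_1^{-1}K_2&a_{42}M_1^{-1}K_2&0&0&0&a_{46}M_1^{-1}K_1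 \\ a_{51}M_1^{-1}K_2&-a_{52}M_1^{-1}K_2&0&0&0&-a_{56}M_1^{-1}K_1 \\ 0&0&-\frac{\beta}{\mu}M_1^{-1}K_2&\gamma\beta M_1^{-1}K_1&-\gamma\beta\frac{I_0}{A_p}M_1^{-1}K_1&0 \end{bmatrix},\qquad B_N=\begin{bmatrix} 0 \\ 0 \\ 0 \\ 0 \\ 0 \\ B_1 \end{bmatrix}.$$ *)

theory Defs
  imports Complex_Main "Jordan_Normal_Form.Gauss_Jordan_Elimination"
begin

definition append_cols :: "'a :: zero mat \<Rightarrow> 'a mat \<Rightarrow> 'a mat" (infixr "@\<^sub>c" 68) where
  "A @\<^sub>c B = four_block_mat A B (0\<^sub>m 0 (dim_col A)) (0\<^sub>m 0 (dim_col B))"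

definition mat_image :: "'a :: semiring_0 mat \<Rightarrow> 'a vec set" where
  "mat_image A = (\<lambda>x. A *\<^sub>v x) ` carrier_vec (dim_col A)"

definition euclid_norm :: "real vec \<Rightarrow> real" where
  "euclid_norm v = sqrt (v \<bullet> v)"

definition brockett_condition :: "nat \<Rightarrow> (real vec \<Rightarrow> 'u \<Rightarrow> real vec) \<Rightarrow> bool" where
  "brockett_condition n f \<longleftrightarrow>
     (\<exists>\<epsilon>>0. \<forall>y\<in>carrier_vec n. euclid_norm y < \<epsilon> \<longrightarrow>
        (\<exists>x\<in>carrier_vec n. \<exists>u. f x u = y))"

text \<open>
  Data of the composite beam. The suffixes \<open>p\<close> and \<open>s\<close> refer to the piezoelectric layer and
  to the substrate. The layer has half-width \<open>g_b\<close> and occupies the heights between \<open>h_a\<close>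
  and \<open>h_b\<close>; \<open>A_s\<close> and \<open>I_s\<close> are the cross-sectional area and the inertia of the substrate;
  \<open>C_p\<close> and \<open>C_s\<close> are the stiffnesses (11-components); \<open>coupling\<close> is the piezoelectric
  constant \<open>\<gamma>\<close>.
\<close>

record piezo =
  rho_p :: real
  rho_s :: real
  C_p :: real
  C_s :: real
  beta :: real
  mu :: real
  coupling :: real
  g_b :: real
  h_a :: real
  h_b :: real
  A_s :: real
  I_s :: real

definition A_p :: "piezo \<Rightarrow> real" where
  "A_p P = 2 * g_b P * (h_b P - h_a P)"

definition I_p :: "piezo \<Rightarrow> real" where
  "I_p P = 2 / 3 * g_b P * (h_b P ^ 3 - h_a P ^ 3)"

definition I_0 :: "piezo \<Rightarrow> real" where
  "I_0 P = g_b P * ((h_b P)\<^sup>2 - (h_a P)\<^sup>2)"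

definition rho_A :: "piezo \<Rightarrow> real" where
  "rho_A P = rho_p P * A_p P + rho_s P * A_s P"

definition rho_I :: "piezo \<Rightarrow> real" where
  "rho_I P = rho_p P * I_p P + rho_s P * I_s P"

definition rho_I0 :: "piezo \<Rightarrow> real" where
  "rho_I0 P = rho_p P * I_0 P"

definition C_A :: "piezo \<Rightarrow> real" where
  "C_A P = C_p P * A_p P + C_s P * A_s P"

definition C_I :: "piezo \<Rightarrow> real" where
  "C_I P = C_p P * I_p P + C_s P * I_s P"

definition C_I0 :: "piezo \<Rightarrow> real" where
  "C_I0 P = C_p P * I_0 P"

definition Delta :: "piezo \<Rightarrow> real" where
  "Delta P = rho_A P * rho_I P - (rho_I0 P)\<^sup>2"

definition a41 :: "piezo \<Rightarrow> real" where
  "a41 P = (rho_I P * C_A P - rho_I0 P * C_I0 P) / Delta P"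

definition a42 :: "piezo \<Rightarrow> real" where
  "a42 P = (rho_I P * C_I0 P - rho_I0 P * C_I P) / Delta P"

definition a46 :: "piezo \<Rightarrow> real" where
  "a46 P = coupling P * ((rho_I P * A_p P - rho_I0 P * I_0 P) / Delta P)"

definition a51 :: "piezo \<Rightarrow> real" where
  "a51 P = (rho_A P * C_I0 P - rho_I0 P * C_A P) / Delta P"

definition a52 :: "piezo \<Rightarrow> real" where
  "a52 P = (rho_A P * C_I P - rho_I0 P * C_I0 P) / Delta P"

definition a56 :: "piezo \<Rightarrow> real" where
  "a56 P = coupling P * ((rho_A P * I_0 P - rho_I0 P * A_p P) / Delta P)"

definition tridiag :: "nat \<Rightarrow> (nat \<Rightarrow> real) \<Rightarrow> (nat \<Rightarrow> real) \<Rightarrow> (nat \<Rightarrow> real) \<Rightarrow> real mat" where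
  "tridiag N l d u = mat N N (\<lambda>(i, j).
     if i = j + 1 then l i else if i = j then d i else if j = i + 1 then u i else 0)"

text \<open>
  In \<open>tridiag N l d u\<close> the arguments give the sub-, main and superdiagonal entry of each row.
  Rows are counted from 0, so the first \<open>N - 2\<close> rows (counted from 1) are those with
  \<open>i + 2 < N\<close>.
\<close>

definition M1 :: "nat \<Rightarrow> real \<Rightarrow> real mat" where
  "M1 N h = (h / 6) \<cdot>\<^sub>m
     tridiag N (\<lambda>i. if i + 2 < N then 1 else 2) (\<lambda>i. 4) (\<lambda>i. if i + 2 < N then 1 else 2)"

definition K1 :: "nat \<Rightarrow> real mat" where
  "K1 N = (1 / 2) \<cdot>\<^sub>m tridiag N (\<lambda>i. 1) (\<lambda>i. 0) (\<lambda>i. -1)"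

definition K2 :: "nat \<Rightarrow> real \<Rightarrow> real mat" where
  "K2 N h = (1 / h) \<cdot>\<^sub>m tridiag N (\<lambda>i. -1) (\<lambda>i. 2) (\<lambda>i. -1)"

definition B1 :: "piezo \<Rightarrow> nat \<Rightarrow> real mat" where
  "B1 P N = mat N 1 (\<lambda>_. - beta P / (2 * g_b P))"

text \<open>\<open>mat_inverse\<close> is option-valued; \<open>M1\<close> is invertible for every \<open>N\<close> whenever \<open>h \<noteq> 0\<close>.\<close>

definition M1_inv :: "nat \<Rightarrow> real \<Rightarrow> real mat" where
  "M1_inv N h = the (mat_inverse (M1 N h))"

definition A_fem :: "piezo \<Rightarrow> nat \<Rightarrow> real \<Rightarrow> real mat" where
  "A_fem P N h =
    (let Z = 0\<^sub>m N N; E = 1\<^sub>m N;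
         L1 = M1_inv N h * K1 N; L2 = M1_inv N h * K2 N h
     in
       (Z @\<^sub>c Z @\<^sub>c Z @\<^sub>c E @\<^sub>c Z @\<^sub>c Z)
    @\<^sub>r (Z @\<^sub>c Z @\<^sub>c Z @\<^sub>c Z @\<^sub>c E @\<^sub>c Z)
    @\<^sub>r (Z @\<^sub>c Z @\<^sub>c Z @\<^sub>c Z @\<^sub>c Z @\<^sub>c E)
    @\<^sub>r (((- a41 P) \<cdot>\<^sub>m L2) @\<^sub>c (a42 P \<cdot>\<^sub>m L2) @\<^sub>c Z @\<^sub>c Z @\<^sub>c Z @\<^sub>c (a46 P \<cdot>\<^sub>m L1))
    @\<^sub>r ((a51 P \<cdot>\<^sub>m L2) @\<^sub>c ((- a52 P) \<cdot>\<^sub>m L2) @\<^sub>c Z @\<^sub>c Z @\<^sub>c Z @\<^sub>c ((- a56 P) \<cdot>\<^sub>m L1))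
    @\<^sub>r (Z @\<^sub>c Z @\<^sub>c ((- (beta P / mu P)) \<cdot>\<^sub>m L2)
          @\<^sub>c ((coupling P * beta P) \<cdot>\<^sub>m L1)
          @\<^sub>c ((- (coupling P * beta P * (I_0 P / A_p P))) \<cdot>\<^sub>m L1) @\<^sub>c Z))"

definition B_fem :: "piezo \<Rightarrow> nat \<Rightarrow> real mat" where
  "B_fem P N = (let z = 0\<^sub>m N 1 in z @\<^sub>r z @\<^sub>r z @\<^sub>r z @\<^sub>r z @\<^sub>r B1 P N)"

definition fem_dynamics :: "piezo \<Rightarrow> nat \<Rightarrow> real \<Rightarrow> real vec \<Rightarrow> real \<Rightarrow> real vec" where
  "fem_dynamics P N h x I = A_fem P N h *\<^sub>v x + B_fem P N *\<^sub>v vec 1 (\<lambda>_. I)"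

end

theory Submission
  imports Defs "Jordan_Normal_Form.Determinant"
begin

text \<open>
  The system satisfies the condition with zero input: \<open>A_fem\<close> alone is already onto. To solve
  \<open>A_fem x = y\<close> block by block, the three identity blocks force \<open>x4 = y1\<close>, \<open>x5 = y2\<close>,
  \<open>x6 = y3\<close>. The terms with \<open>K1\<close> involve only these blocks, so they can be moved to the
  right-hand side.
  What remains are three equations in \<open>x1\<close>, \<open>x2\<close>, \<open>x3\<close> in which every unknown is multiplied by
  a scalar multiple of the same matrix \<open>L2 = M1\<inverse> K2\<close>. They are solvable for two reasons.

  The matrix \<open>L2\<close> is onto, since \<open>M1\<close> and \<open>K2\<close> are nonsingular. Both are tridiagonal and weakly
  diagonally dominant with nonzero subdiagonal, which suffices by a maximum principle
  (\<open>det_tridiag_nonzero\<close>).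

  The scalar 2 by 2 system for \<open>x1\<close>, \<open>x2\<close> has determinant
  \<open>a41 a52 - a42 a51 = (C_A C_I - C_I0\<^sup>2) / Delta\<close>. Numerator and denominator are the determinants
  of the symmetric moment matrices of the composite, weighted by stiffness and by density.
  The Cauchy-Schwarz inequality for the moments of the piezoelectric layer,
  \<open>I_0\<^sup>2 < A_p I_p\<close>, makes that layer's contribution positive definite, and the substrate only adds
  a positive diagonal (\<open>coupling_det_nonzero\<close>).
\<close>

section \<open>Nonsingular tridiagonal matrices\<close>

lemma tridiag_mult_vec_nth:
  assumes "x \<in> carrier_vec N" "i < N"
  shows "(tridiag N l d u *\<^sub>v x) $ i =
    (if 0 < i then l i * x $ (i - 1) else 0) + d i * x $ i
      + (if i + 1 < N then u i * x $ (i + 1) else 0)"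
proof -
  have "(tridiag N l d u *\<^sub>v x) $ i =
     (\<Sum>j = 0..<N. (if i = j + 1 then l i else if i = j then d i
        else if j = i + 1 then u i else 0) * x $ j)"
    using assms by (auto simp: tridiag_def scalar_prod_def)
  also have "\<dots> = (\<Sum>j = 0..<N.
       (if j = i - 1 then (if 0 < i then l i * x $ (i - 1) else 0) else 0)
       + (if j = i then d i * x $ i else 0)
       + (if j = i + 1 then u i * x $ (i + 1) else 0))"
    by (rule sum.cong) auto
  also have "\<dots> = (if 0 < i then l i * x $ (i - 1) else 0) + d i * x $ i
      + (if i + 1 < N then u i * x $ (i + 1) else 0)"
    using assms(2) by (simp add: sum.distrib sum.delta)
  finally show ?thesis .
qed

lemma tridiag_carrier [simp]: "tridiag N l d u \<in> carrier_mat N N"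
  by (simp add: tridiag_def)

text \<open>
  Weak dominance is all that is available: in \<open>K2\<close> the interior rows, and in \<open>M1\<close> the row before
  the last, satisfy it with equality. A maximum principle replaces strictness. Take a kernel vector
  and the first index where its entries attain their maximal modulus. The left neighbour is then
  strictly smaller (or absent, which counts as 0), and because the subdiagonal entry is nonzero
  the off-diagonal terms of that row cannot balance the diagonal one. Asking for \<open>l 0 \<noteq> 0\<close>, an
  entry that lies outside the matrix, encodes strict dominance of the first row.
\<close>

lemma det_tridiag_nonzero:
  assumes dom: "\<And>i. i < N \<Longrightarrow> \<bar>l i\<bar> + \<bar>u i\<bar> \<le> \<bar>d i\<bar>"
    and sub: "\<And>i. i < N \<Longrightarrow> l i \<noteq> 0"
  shows "det (tridiag N l d u) \<noteq> 0"
proof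
  assume "det (tridiag N l d u) = 0"
  then obtain x where x: "x \<in> carrier_vec N" "x \<noteq> 0\<^sub>v N"
    and ker: "tridiag N l d u *\<^sub>v x = 0\<^sub>v N"
    using det_0_iff_vec_prod_zero_field[OF tridiag_carrier[of N l d u]] by blast
  obtain k where k: "k < N" "x $ k \<noteq> 0"
    using x by (metis carrier_vecD eq_vecI index_zero_vec)
  define m where "m = Max ((\<lambda>i. \<bar>x $ i\<bar>) ` {..<N})"
  have le_m: "\<bar>x $ i\<bar> \<le> m" if "i < N" for i
    unfolding m_def using that by (intro Max_ge) auto
  have "m > 0"
    using le_m[OF k(1)] k(2) by linarith
  have "m \<in> (\<lambda>i. \<bar>x $ i\<bar>) ` {..<N}"
    unfolding m_def using k(1) by (intro Max_in) auto
  then have "\<exists>i. i < N \<and> \<bar>x $ i\<bar> = m" by auto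
  define i where "i = (LEAST i. i < N \<and> \<bar>x $ i\<bar> = m)"
  have i: "i < N" "\<bar>x $ i\<bar> = m"
    using LeastI_ex[OF \<open>\<exists>i. i < N \<and> \<bar>x $ i\<bar> = m\<close>] unfolding i_def by auto
  have first: "\<bar>x $ j\<bar> \<noteq> m" if "j < i" for j
    using not_less_Least[of j "\<lambda>i. i < N \<and> \<bar>x $ i\<bar> = m"] that i(1) unfolding i_def by auto
  \<comment> \<open>The two neighbours of the extremal entry, continued by 0 outside the index range.\<close>
  define a where "a = (if 0 < i then x $ (i - 1) else 0)"
  define b where "b = (if i + 1 < N then x $ (i + 1) else 0)"
  have a: "\<bar>a\<bar> < m"
  proof (cases "0 < i")
    case True
    then have "\<bar>x $ (i - 1)\<bar> \<noteq> m" "\<bar>x $ (i - 1)\<bar> \<le> m"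
      using first[of "i - 1"] le_m[of "i - 1"] i(1) by auto
    then show ?thesis using True unfolding a_def by simp
  qed (use \<open>m > 0\<close> in \<open>simp add: a_def\<close>)
  have b: "\<bar>b\<bar> \<le> m"
    using le_m[of "i + 1"] \<open>m > 0\<close> unfolding b_def by auto
  have "l i * a + d i * x $ i + u i * b = 0"
    using tridiag_mult_vec_nth[OF x(1) i(1), of l d u] ker i(1)
    unfolding a_def b_def by (auto split: if_splits)
  then have "\<bar>d i * x $ i\<bar> = \<bar>l i * a + u i * b\<bar>" by linarith
  also have "\<dots> \<le> \<bar>l i\<bar> * \<bar>a\<bar> + \<bar>u i\<bar> * \<bar>b\<bar>"
    by (metis abs_mult abs_triangle_ineq)
  also have "\<dots> < \<bar>l i\<bar> * m + \<bar>u i\<bar> * m"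
    using a b sub[OF i(1)] by (intro add_less_le_mono mult_strict_left_mono mult_left_mono) auto
  also have "\<dots> \<le> \<bar>d i\<bar> * m"
    using dom[OF i(1)] \<open>m > 0\<close>
    by (metis distrib_right less_eq_real_def mult_right_mono)
  finally show False using i(2) by (simp add: abs_mult)
qed

section \<open>The element matrices\<close>

lemma M1_carrier [simp]: "M1 N h \<in> carrier_mat N N"
  and K1_carrier [simp]: "K1 N \<in> carrier_mat N N"
  and K2_carrier [simp]: "K2 N h \<in> carrier_mat N N"
  and B1_carrier [simp]: "B1 P N \<in> carrier_mat N 1"
  by (simp_all add: M1_def K1_def K2_def B1_def)

lemma det_M1_nonzero:
  assumes "h \<noteq> 0" shows "det (M1 N h) \<noteq> 0"
  using assms unfolding M1_def by (simp, intro det_tridiag_nonzero) auto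

lemma det_K2_nonzero:
  assumes "h \<noteq> 0" shows "det (K2 N h) \<noteq> 0"
  using assms unfolding K2_def by (simp, intro det_tridiag_nonzero) auto

lemma mat_inverse_det_nonzero:
  fixes A :: "'a :: field mat"
  assumes "A \<in> carrier_mat n n" "det A \<noteq> 0"
  shows "A * the (mat_inverse A) = 1\<^sub>m n" "the (mat_inverse A) * A = 1\<^sub>m n"
    "the (mat_inverse A) \<in> carrier_mat n n"
  using mat_inverse[OF assms(1)] det_non_zero_imp_unit[OF assms]
  by (metis option.collapse)+

lemma M1_inv_carrier [simp]: "h \<noteq> 0 \<Longrightarrow> M1_inv N h \<in> carrier_mat N N"
  unfolding M1_inv_def by (intro mat_inverse_det_nonzero(3) M1_carrier det_M1_nonzero)

text \<open>
  A preimage of \<open>r\<close> is \<open>K2\<inverse> (M1 r)\<close>.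
\<close>

lemma M1_inv_K2_surj:
  assumes "h \<noteq> 0" and r: "r \<in> carrier_vec N"
  obtains v where "v \<in> carrier_vec N" "(M1_inv N h * K2 N h) *\<^sub>v v = r"
proof -
  let ?M = "M1 N h" and ?M' = "M1_inv N h" and ?K = "K2 N h" and ?K' = "the (mat_inverse (K2 N h))"
  have inv: "?M' * ?M = 1\<^sub>m N" "?K * ?K' = 1\<^sub>m N" "?K' \<in> carrier_mat N N"
    unfolding M1_inv_def using assms(1)
    by (simp_all add: mat_inverse_det_nonzero det_M1_nonzero det_K2_nonzero)
  have M': "?M' \<in> carrier_mat N N" using assms(1) by simp
  have w: "?M *\<^sub>v r \<in> carrier_vec N" using mult_mat_vec_carrier[OF M1_carrier r] .
  define v where "v = ?K' *\<^sub>v (?M *\<^sub>v r)"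
  have v: "v \<in> carrier_vec N" unfolding v_def using mult_mat_vec_carrier[OF inv(3) w] .
  have "?K *\<^sub>v v = ?M *\<^sub>v r"
    unfolding v_def assoc_mult_mat_vec[OF K2_carrier inv(3) w, symmetric] inv(2)
    using w by simp
  then have "(?M' * ?K) *\<^sub>v v = ?M' *\<^sub>v (?M *\<^sub>v r)"
    using assoc_mult_mat_vec[OF M' K2_carrier v] by simp
  also have "\<dots> = r"
    unfolding assoc_mult_mat_vec[OF M' M1_carrier r, symmetric] inv(1) using r by simp
  finally show thesis using that v by blast
qed

section \<open>Block matrices acting on block vectors\<close>

lemma smult_mat_mult_vec:
  fixes A :: "'a :: comm_semiring_0 mat"
  assumes "A \<in> carrier_mat r c" "x \<in> carrier_vec c"
  shows "(k \<cdot>\<^sub>m A) *\<^sub>v x = k \<cdot>\<^sub>v (A *\<^sub>v x)"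
  using assms by (intro eq_vecI) (auto simp: scalar_prod_def sum_distrib_left mult.assoc)

lemma append_cols_carrier [simp]:
  assumes "A \<in> carrier_mat r c1" "B \<in> carrier_mat r c2"
  shows "A @\<^sub>c B \<in> carrier_mat r (c1 + c2)"
  using assms unfolding append_cols_def carrier_mat_def by simp

lemma append_cols_mult_append_vec:
  assumes A: "A \<in> carrier_mat r c1" and B: "B \<in> carrier_mat r c2"
    and x: "x \<in> carrier_vec c1" and y: "y \<in> carrier_vec c2"
  shows "(A @\<^sub>c B) *\<^sub>v (x @\<^sub>v y) = A *\<^sub>v x + B *\<^sub>v y"
proof -
  have "(A @\<^sub>c B) *\<^sub>v (x @\<^sub>v y) =
    (A *\<^sub>v x + B *\<^sub>v y) @\<^sub>v (0\<^sub>m 0 c1 *\<^sub>v x + 0\<^sub>m 0 c2 *\<^sub>v y)"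
    using A B four_block_mat_mult_vec[OF A B zero_carrier_mat zero_carrier_mat x y, of 0]
    unfolding append_cols_def by auto
  also have "\<dots> = A *\<^sub>v x + B *\<^sub>v y"
    by (rule eq_vecI) (use A B in auto)
  finally show ?thesis .
qed

lemma six_times_eq_sum: "6 * n = n + (n + (n + (n + (n + (n :: nat)))))"
  by simp

lemma append_cols6_mult_append_vec:
  assumes A: "A1 \<in> carrier_mat r c" "A2 \<in> carrier_mat r c" "A3 \<in> carrier_mat r c"
    "A4 \<in> carrier_mat r c" "A5 \<in> carrier_mat r c" "A6 \<in> carrier_mat r c"
    and x: "x1 \<in> carrier_vec c" "x2 \<in> carrier_vec c" "x3 \<in> carrier_vec c"
    "x4 \<in> carrier_vec c" "x5 \<in> carrier_vec c" "x6 \<in> carrier_vec c"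
  shows "(A1 @\<^sub>c A2 @\<^sub>c A3 @\<^sub>c A4 @\<^sub>c A5 @\<^sub>c A6) *\<^sub>v (x1 @\<^sub>v x2 @\<^sub>v x3 @\<^sub>v x4 @\<^sub>v x5 @\<^sub>v x6) =
    A1 *\<^sub>v x1 + (A2 *\<^sub>v x2 + (A3 *\<^sub>v x3 + (A4 *\<^sub>v x4 + (A5 *\<^sub>v x5 + A6 *\<^sub>v x6))))"
proof -
  note A5 = append_cols_carrier[OF A(5,6)]
  note A4 = append_cols_carrier[OF A(4) A5]
  note A3 = append_cols_carrier[OF A(3) A4]
  note A2 = append_cols_carrier[OF A(2) A3]
  note x5 = append_carrier_vec[OF x(5,6)]
  note x4 = append_carrier_vec[OF x(4) x5]
  note x3 = append_carrier_vec[OF x(3) x4]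
  note x2 = append_carrier_vec[OF x(2) x3]
  show ?thesis
    unfolding append_cols_mult_append_vec[OF A(1) A2 x(1) x2]
      append_cols_mult_append_vec[OF A(2) A3 x(2) x3]
      append_cols_mult_append_vec[OF A(3) A4 x(3) x4]
      append_cols_mult_append_vec[OF A(4) A5 x(4) x5]
      append_cols_mult_append_vec[OF A(5,6) x(5,6)] ..
qed

lemma append_cols6_carrier:
  assumes "A1 \<in> carrier_mat r c" "A2 \<in> carrier_mat r c" "A3 \<in> carrier_mat r c"
    "A4 \<in> carrier_mat r c" "A5 \<in> carrier_mat r c" "A6 \<in> carrier_mat r c"
  shows "A1 @\<^sub>c A2 @\<^sub>c A3 @\<^sub>c A4 @\<^sub>c A5 @\<^sub>c A6 \<in> carrier_mat r (6 * c)"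
proof -
  show ?thesis unfolding six_times_eq_sum by (intro append_cols_carrier assms)
qed

lemma append_rows6_carrier:
  assumes "A1 \<in> carrier_mat r c" "A2 \<in> carrier_mat r c" "A3 \<in> carrier_mat r c"
    "A4 \<in> carrier_mat r c" "A5 \<in> carrier_mat r c" "A6 \<in> carrier_mat r c"
  shows "A1 @\<^sub>r A2 @\<^sub>r A3 @\<^sub>r A4 @\<^sub>r A5 @\<^sub>r A6 \<in> carrier_mat (6 * r) c"
proof -
  show ?thesis unfolding six_times_eq_sum by (intro carrier_append_rows assms)
qed

lemma append_rows6_mult_vec:
  assumes A: "A1 \<in> carrier_mat r c" "A2 \<in> carrier_mat r c" "A3 \<in> carrier_mat r c"
    "A4 \<in> carrier_mat r c" "A5 \<in> carrier_mat r c" "A6 \<in> carrier_mat r c"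
    and x: "x \<in> carrier_vec c"
  shows "(A1 @\<^sub>r A2 @\<^sub>r A3 @\<^sub>r A4 @\<^sub>r A5 @\<^sub>r A6) *\<^sub>v x =
    (A1 *\<^sub>v x) @\<^sub>v (A2 *\<^sub>v x) @\<^sub>v (A3 *\<^sub>v x) @\<^sub>v (A4 *\<^sub>v x) @\<^sub>v (A5 *\<^sub>v x) @\<^sub>v (A6 *\<^sub>v x)"
proof -
  note A5 = carrier_append_rows[OF A(5,6)]
  note A4 = carrier_append_rows[OF A(4) A5]
  note A3 = carrier_append_rows[OF A(3) A4]
  note A2 = carrier_append_rows[OF A(2) A3]
  show ?thesis
    unfolding mat_mult_append[OF A(1) A2 x] mat_mult_append[OF A(2) A3 x]
      mat_mult_append[OF A(3) A4 x] mat_mult_append[OF A(4) A5 x]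
      mat_mult_append[OF A(5,6) x] ..
qed

lemma append_vec6_carrier:
  assumes "x1 \<in> carrier_vec n" "x2 \<in> carrier_vec n" "x3 \<in> carrier_vec n"
    "x4 \<in> carrier_vec n" "x5 \<in> carrier_vec n" "x6 \<in> carrier_vec n"
  shows "x1 @\<^sub>v x2 @\<^sub>v x3 @\<^sub>v x4 @\<^sub>v x5 @\<^sub>v x6 \<in> carrier_vec (6 * n)"
  unfolding six_times_eq_sum by (intro append_carrier_vec assms)

lemma append_vec_split:
  assumes "v \<in> carrier_vec (n + m)"
  obtains a b where "a \<in> carrier_vec n" "b \<in> carrier_vec m" "v = a @\<^sub>v b"
  by (rule that[OF vec_first_carrier vec_last_carrier vec_first_last_append[OF assms, symmetric]])

lemma append_vec6_cases:
  assumes "y \<in> carrier_vec (6 * n)"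
  obtains y1 y2 y3 y4 y5 y6 where
    "y1 \<in> carrier_vec n" "y2 \<in> carrier_vec n" "y3 \<in> carrier_vec n"
    "y4 \<in> carrier_vec n" "y5 \<in> carrier_vec n" "y6 \<in> carrier_vec n"
    "y = y1 @\<^sub>v y2 @\<^sub>v y3 @\<^sub>v y4 @\<^sub>v y5 @\<^sub>v y6"
proof -
  note y = assms[unfolded six_times_eq_sum]
  obtain y1 z1 where 1: "y1 \<in> carrier_vec n" "y = y1 @\<^sub>v z1"
    and z1: "z1 \<in> carrier_vec (n + (n + (n + (n + n))))"
    using append_vec_split[OF y] .
  obtain y2 z2 where 2: "y2 \<in> carrier_vec n" "z1 = y2 @\<^sub>v z2"
    and z2: "z2 \<in> carrier_vec (n + (n + (n + n)))"
    using append_vec_split[OF z1] .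
  obtain y3 z3 where 3: "y3 \<in> carrier_vec n" "z2 = y3 @\<^sub>v z3"
    and z3: "z3 \<in> carrier_vec (n + (n + n))"
    using append_vec_split[OF z2] .
  obtain y4 z4 where 4: "y4 \<in> carrier_vec n" "z3 = y4 @\<^sub>v z4"
    and z4: "z4 \<in> carrier_vec (n + n)"
    using append_vec_split[OF z3] .
  obtain y5 y6 where 5: "y5 \<in> carrier_vec n" "z4 = y5 @\<^sub>v y6"
    and 6: "y6 \<in> carrier_vec n"
    using append_vec_split[OF z4] .
  show thesis
    using that[OF 1(1) 2(1) 3(1) 4(1) 5(1) 6] unfolding 1(2) 2(2) 3(2) 4(2) 5(2) by blast
qed

section \<open>The system matrices in block form\<close>

lemma A_fem_carrier:
  assumes "h \<noteq> 0" shows "A_fem P N h \<in> carrier_mat (6 * N) (6 * N)"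
  unfolding A_fem_def Let_def
  by (intro append_rows6_carrier append_cols6_carrier smult_carrier_mat
      mult_carrier_mat[of _ N N] M1_inv_carrier[OF assms] K1_carrier K2_carrier
      zero_carrier_mat one_carrier_mat)

lemma B_fem_carrier: "B_fem P N \<in> carrier_mat (6 * N) 1"
  unfolding B_fem_def Let_def by (intro append_rows6_carrier zero_carrier_mat B1_carrier)

text \<open>
  In the last three block rows, \<open>x1\<close>, \<open>x2\<close>, \<open>x3\<close> enter only through \<open>L2\<close> and \<open>x4\<close>, \<open>x5\<close>,
  \<open>x6\<close> only through \<open>L1\<close>. Collecting each \<open>L2\<close> contribution into one application of \<open>L2\<close>
  separates the scalar part of the problem from the matrix part.
\<close>

lemma A_fem_mult_append_vec:
  fixes P :: piezo
  assumes "h \<noteq> 0"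
    and x: "x1 \<in> carrier_vec N" "x2 \<in> carrier_vec N" "x3 \<in> carrier_vec N"
    "x4 \<in> carrier_vec N" "x5 \<in> carrier_vec N" "x6 \<in> carrier_vec N"
  defines "L1 \<equiv> M1_inv N h * K1 N" and "L2 \<equiv> M1_inv N h * K2 N h"
  shows "A_fem P N h *\<^sub>v (x1 @\<^sub>v x2 @\<^sub>v x3 @\<^sub>v x4 @\<^sub>v x5 @\<^sub>v x6) =
    x4 @\<^sub>v x5 @\<^sub>v x6
    @\<^sub>v (L2 *\<^sub>v (- a41 P \<cdot>\<^sub>v x1 + a42 P \<cdot>\<^sub>v x2) + a46 P \<cdot>\<^sub>v (L1 *\<^sub>v x6))
    @\<^sub>v (L2 *\<^sub>v (a51 P \<cdot>\<^sub>v x1 + - a52 P \<cdot>\<^sub>v x2) + - a56 P \<cdot>\<^sub>v (L1 *\<^sub>v x6))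
    @\<^sub>v (L2 *\<^sub>v (- (beta P / mu P) \<cdot>\<^sub>v x3)
      + (coupling P * beta P \<cdot>\<^sub>v (L1 *\<^sub>v x4)
      + - (coupling P * beta P * (I_0 P / A_p P)) \<cdot>\<^sub>v (L1 *\<^sub>v x5)))"
proof -
  have L: "L1 \<in> carrier_mat N N" "L2 \<in> carrier_mat N N"
    unfolding L1_def L2_def using assms(1) by (auto intro: mult_carrier_mat[of _ N N])
  have L': "L1 *\<^sub>v v \<in> carrier_vec N" "L2 *\<^sub>v v \<in> carrier_vec N"
    if "v \<in> carrier_vec N" for v
    using L that by (auto intro: mult_mat_vec_carrier)
  have zero: "0\<^sub>m N N *\<^sub>v v = 0\<^sub>v N" if "v \<in> carrier_vec N" for v :: "real vec"
    using that by (intro eq_vecI) auto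
  let ?Z = "0\<^sub>m N N :: real mat" and ?E = "1\<^sub>m N :: real mat"
    and ?x = "x1 @\<^sub>v x2 @\<^sub>v x3 @\<^sub>v x4 @\<^sub>v x5 @\<^sub>v x6"
  have Z: "?Z \<in> carrier_mat N N" and E: "?E \<in> carrier_mat N N" by simp_all
  have kL: "k \<cdot>\<^sub>m L1 \<in> carrier_mat N N" "k \<cdot>\<^sub>m L2 \<in> carrier_mat N N" for k
    using L by simp_all
  note rules = L' zero x smult_mat_mult_vec[OF L(1)] smult_mat_mult_vec[OF L(2)]
    mult_mat_vec[OF L(2)] mult_add_distrib_mat_vec[OF L(2)] assoc_add_vec[of _ N]
  have row1: "(?Z @\<^sub>c ?Z @\<^sub>c ?Z @\<^sub>c ?E @\<^sub>c ?Z @\<^sub>c ?Z) *\<^sub>v ?x = x4"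
    unfolding append_cols6_mult_append_vec[OF Z Z Z E Z Z x] using x by (simp add: zero)
  have row2: "(?Z @\<^sub>c ?Z @\<^sub>c ?Z @\<^sub>c ?Z @\<^sub>c ?E @\<^sub>c ?Z) *\<^sub>v ?x = x5"
    unfolding append_cols6_mult_append_vec[OF Z Z Z Z E Z x] using x by (simp add: zero)
  have row3: "(?Z @\<^sub>c ?Z @\<^sub>c ?Z @\<^sub>c ?Z @\<^sub>c ?Z @\<^sub>c ?E) *\<^sub>v ?x = x6"
    unfolding append_cols6_mult_append_vec[OF Z Z Z Z Z E x] using x by (simp add: zero)
  have row45: "((k \<cdot>\<^sub>m L2) @\<^sub>c (l \<cdot>\<^sub>m L2) @\<^sub>c ?Z @\<^sub>c ?Z @\<^sub>c ?Z @\<^sub>c (m \<cdot>\<^sub>m L1)) *\<^sub>v ?x =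
    L2 *\<^sub>v (k \<cdot>\<^sub>v x1 + l \<cdot>\<^sub>v x2) + m \<cdot>\<^sub>v (L1 *\<^sub>v x6)" for k l m
    unfolding append_cols6_mult_append_vec[OF kL(2) kL(2) Z Z Z kL(1) x] by (simp add: rules)
  have row6: "(?Z @\<^sub>c ?Z @\<^sub>c (k \<cdot>\<^sub>m L2) @\<^sub>c (l \<cdot>\<^sub>m L1) @\<^sub>c (m \<cdot>\<^sub>m L1) @\<^sub>c ?Z) *\<^sub>v ?x =
    L2 *\<^sub>v (k \<cdot>\<^sub>v x3) + (l \<cdot>\<^sub>v (L1 *\<^sub>v x4) + m \<cdot>\<^sub>v (L1 *\<^sub>v x5))" for k l m
    unfolding append_cols6_mult_append_vec[OF Z Z kL(2) kL(1) kL(1) Z x] by (simp add: rules)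
  note append_rows6_mult_vec[OF append_cols6_carrier[OF Z Z Z E Z Z]
      append_cols6_carrier[OF Z Z Z Z E Z] append_cols6_carrier[OF Z Z Z Z Z E]
      append_cols6_carrier[OF kL(2) kL(2) Z Z Z kL(1)]
      append_cols6_carrier[OF kL(2) kL(2) Z Z Z kL(1)]
      append_cols6_carrier[OF Z Z kL(2) kL(1) kL(1) Z] append_vec6_carrier[OF x],
      unfolded row1 row2 row3 row45 row6]
  then show ?thesis
    unfolding A_fem_def Let_def L1_def[symmetric] L2_def[symmetric] .
qed

section \<open>The constants of the composite\<close>

text \<open>
  Up to the factor \<open>2 g_b\<close>, the numbers \<open>A_p\<close>, \<open>I_0\<close>, \<open>I_p\<close> are the integrals of \<open>1\<close>, \<open>z\<close>,
  \<open>z\<^sup>2\<close> over the heights \<open>z\<close> of the layer. The middle inequality is therefore Cauchy-Schwarz,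
  strict because \<open>z\<close> is not constant on an interval of positive length; the gap is
  \<open>g_b\<^sup>2 (h_b - h_a)\<^sup>4 / 3\<close>.
\<close>

lemma layer_moments_pos:
  assumes "g_b P > 0" "h_a P < h_b P"
  shows "A_p P > 0" "(I_0 P)\<^sup>2 < A_p P * I_p P" "I_p P > 0"
proof -
  show A: "A_p P > 0" using assms by (simp add: A_p_def)
  have "A_p P * I_p P - (I_0 P)\<^sup>2 = (g_b P)\<^sup>2 * (h_b P - h_a P) ^ 4 / 3"
    unfolding A_p_def I_p_def I_0_def by (simp add: field_simps power2_eq_square power3_eq_cube power4_eq_xxxx)
  also have "\<dots> > 0" using assms by simp
  finally show I: "(I_0 P)\<^sup>2 < A_p P * I_p P" by simp
  then have "0 < A_p P * I_p P" using zero_le_power2[of "I_0 P"] by linarith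
  with A show "I_p P > 0" by (simp add: zero_less_mult_iff)
qed

text \<open>
  The right-hand side is the determinant of a positive multiple of the positive definite matrix
  with rows \<open>(A, J)\<close> and \<open>(J, I)\<close>, plus a positive diagonal matrix. Taking densities or
  stiffnesses for \<open>c\<close>, \<open>c'\<close> covers both the mass and the stiffness of the beam.
\<close>

lemma composite_moments_pos:
  fixes c c' A I J A' I' :: real
  assumes "0 < c" "0 < c'" "0 < A" "0 < I" "J\<^sup>2 < A * I" "0 < A'" "0 < I'"
  shows "0 < (c * A + c' * A') * (c * I + c' * I') - (c * J)\<^sup>2"
proof -
  have "(c * A + c' * A') * (c * I + c' * I') - (c * J)\<^sup>2 =
    c\<^sup>2 * (A * I - J\<^sup>2) + (c * c' * (A * I' + A' * I) + c'\<^sup>2 * (A' * I'))"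
    by (simp add: algebra_simps power2_eq_square)
  also have "\<dots> > 0"
    using assms by (intro add_pos_pos mult_pos_pos) auto
  finally show ?thesis .
qed

text \<open>
  The matrix with rows \<open>(a41, a42)\<close>, \<open>(a51, a52)\<close> is the inverse of the mass matrix, with rows
  \<open>(rho_A, rho_I0)\<close>, \<open>(rho_I0, rho_I)\<close>, times the analogous stiffness matrix. Its determinant is
  therefore a quotient of two positive determinants.
\<close>

lemma coupling_det_nonzero:
  assumes "rho_p P > 0" "rho_s P > 0" "C_p P > 0" "C_s P > 0"
    and "g_b P > 0" "h_a P < h_b P" "A_s P > 0" "I_s P > 0"
  shows "a41 P * a52 P - a42 P * a51 P \<noteq> 0"
proof -
  note mom = layer_moments_pos[OF assms(5,6)]
  have D: "Delta P > 0"
    unfolding Delta_def rho_A_def rho_I_def rho_I0_def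
    using composite_moments_pos[OF assms(1,2) mom(1,3,2) assms(7,8)] .
  have C: "C_A P * C_I P - (C_I0 P)\<^sup>2 > 0"
    unfolding C_A_def C_I_def C_I0_def
    using composite_moments_pos[OF assms(3,4) mom(1,3,2) assms(7,8)] .
  have "(a41 P * a52 P - a42 P * a51 P) * (Delta P)\<^sup>2 =
    (rho_A P * rho_I P - (rho_I0 P)\<^sup>2) * (C_A P * C_I P - (C_I0 P)\<^sup>2)"
    using D unfolding a41_def a42_def a51_def a52_def
    by (simp add: field_simps power2_eq_square)
  also have "\<dots> = Delta P * (C_A P * C_I P - (C_I0 P)\<^sup>2)"
    by (simp add: Delta_def)
  finally show ?thesis using D C by auto
qed

section \<open>Surjectivity\<close>

lemma A_fem_surj:
  assumes h: "h \<noteq> 0" and "beta P \<noteq> 0" "mu P \<noteq> 0"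
    and D: "a41 P * a52 P - a42 P * a51 P \<noteq> 0"
    and y: "y \<in> carrier_vec (6 * N)"
  shows "\<exists>x \<in> carrier_vec (6 * N). A_fem P N h *\<^sub>v x = y"
proof -
  obtain y1 y2 y3 y4 y5 y6 where yi:
    "y1 \<in> carrier_vec N" "y2 \<in> carrier_vec N" "y3 \<in> carrier_vec N"
    "y4 \<in> carrier_vec N" "y5 \<in> carrier_vec N" "y6 \<in> carrier_vec N"
    and y_eq: "y = y1 @\<^sub>v y2 @\<^sub>v y3 @\<^sub>v y4 @\<^sub>v y5 @\<^sub>v y6"
    using append_vec6_cases[OF y] .
  define L1 where "L1 = M1_inv N h * K1 N"
  define L2 where "L2 = M1_inv N h * K2 N h"
  \<comment> \<open>Contributions of the already determined blocks \<open>x4 = y1\<close>, \<open>x5 = y2\<close>, \<open>x6 = y3\<close>.\<close>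
  define s where "s = a46 P \<cdot>\<^sub>v (L1 *\<^sub>v y3)"
  define t where "t = - a56 P \<cdot>\<^sub>v (L1 *\<^sub>v y3)"
  define w where "w = coupling P * beta P \<cdot>\<^sub>v (L1 *\<^sub>v y1)
      + - (coupling P * beta P * (I_0 P / A_p P)) \<cdot>\<^sub>v (L1 *\<^sub>v y2)"
  have L1: "L1 \<in> carrier_mat N N"
    unfolding L1_def using h by (auto intro: mult_carrier_mat[of _ N N])
  have stw: "s \<in> carrier_vec N" "t \<in> carrier_vec N" "w \<in> carrier_vec N"
    unfolding s_def t_def w_def using L1 yi by (auto intro: mult_mat_vec_carrier)
  obtain p where p: "p \<in> carrier_vec N" "L2 *\<^sub>v p = y4 - s"
    using M1_inv_K2_surj[OF h, of "y4 - s" N] yi stw unfolding L2_def by auto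
  obtain q where q: "q \<in> carrier_vec N" "L2 *\<^sub>v q = y5 - t"
    using M1_inv_K2_surj[OF h, of "y5 - t" N] yi stw unfolding L2_def by auto
  obtain r where r: "r \<in> carrier_vec N" "L2 *\<^sub>v r = y6 - w"
    using M1_inv_K2_surj[OF h, of "y6 - w" N] yi stw unfolding L2_def by auto
  define D where "D = a41 P * a52 P - a42 P * a51 P"
  have D0: "D \<noteq> 0" using D unfolding D_def .
  \<comment> \<open>Cramer's rule for the 2 by 2 system; the matrix with rows \<open>(- a41, a42)\<close> and
    \<open>(a51, - a52)\<close> has determinant \<open>D\<close>.\<close>
  define x1 where "x1 = (- (1 / D)) \<cdot>\<^sub>v (a52 P \<cdot>\<^sub>v p + a42 P \<cdot>\<^sub>v q)"
  define x2 where "x2 = (- (1 / D)) \<cdot>\<^sub>v (a51 P \<cdot>\<^sub>v p + a41 P \<cdot>\<^sub>v q)"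
  define x3 where "x3 = (- (mu P / beta P)) \<cdot>\<^sub>v r"
  have x: "x1 \<in> carrier_vec N" "x2 \<in> carrier_vec N" "x3 \<in> carrier_vec N"
    unfolding x1_def x2_def x3_def using p q r by auto
  have cramer1: "- a41 P * (- (1 / D) * (a52 P * u + a42 P * v))
      + a42 P * (- (1 / D) * (a51 P * u + a41 P * v)) = u" for u v
    using D0 by (simp add: divide_simps) (simp add: D_def algebra_simps)
  have cramer2: "a51 P * (- (1 / D) * (a52 P * u + a42 P * v))
      + - a52 P * (- (1 / D) * (a51 P * u + a41 P * v)) = v" for u v
    using D0 by (simp add: divide_simps) (simp add: D_def algebra_simps)
  have e4: "- a41 P \<cdot>\<^sub>v x1 + a42 P \<cdot>\<^sub>v x2 = p"
    unfolding x1_def x2_def using p(1) q(1) cramer1 by (intro eq_vecI) auto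
  have e5: "a51 P \<cdot>\<^sub>v x1 + - a52 P \<cdot>\<^sub>v x2 = q"
    unfolding x1_def x2_def using p(1) q(1) cramer2 by (intro eq_vecI) auto
  have e6: "- (beta P / mu P) \<cdot>\<^sub>v x3 = r"
    unfolding x3_def using r(1) assms(2,3) by (intro eq_vecI) auto
  have cancel: "(u - v) + v = u" if "u \<in> carrier_vec N" "v \<in> carrier_vec N" for u v :: "real vec"
    using that by (intro eq_vecI) auto
  have "A_fem P N h *\<^sub>v (x1 @\<^sub>v x2 @\<^sub>v x3 @\<^sub>v y1 @\<^sub>v y2 @\<^sub>v y3) =
    y1 @\<^sub>v y2 @\<^sub>v y3 @\<^sub>v (L2 *\<^sub>v p + s) @\<^sub>v (L2 *\<^sub>v q + t) @\<^sub>v (L2 *\<^sub>v r + w)"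
    unfolding A_fem_mult_append_vec[OF h x yi(1-3)] L1_def[symmetric] L2_def[symmetric]
      e4 e5 e6 s_def t_def w_def ..
  also have "\<dots> = y"
    unfolding p(2) q(2) r(2) y_eq using yi stw by (simp add: cancel)
  finally show ?thesis
    using append_vec6_carrier[OF x yi(1-3)] by blast
qed

theorem theorem4:
  fixes P :: piezo and h :: real and N :: nat
  assumes "rho_p P > 0" "rho_s P > 0" "C_p P > 0" "C_s P > 0"
    and "beta P > 0" "mu P > 0"
    and "g_b P > 0" "h_a P < h_b P"
    and "A_s P > 0" "I_s P > 0"
    and "h > 0" "N \<ge> 1"
  shows "brockett_condition (6 * N) (fem_dynamics P N h)
    \<and> mat_image (A_fem P N h @\<^sub>c B_fem P N) = carrier_vec (6 * N)"
proof -
  have h: "h \<noteq> 0" using assms by simp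
  note A = A_fem_carrier[OF h, of P N] and B = B_fem_carrier[of P N]
  have B0: "B_fem P N *\<^sub>v 0\<^sub>v 1 = 0\<^sub>v (6 * N)"
    using B by (intro eq_vecI) auto
  have nz: "beta P \<noteq> 0" "mu P \<noteq> 0" using assms by simp_all
  note surj = A_fem_surj[OF h nz coupling_det_nonzero[OF assms(1-4,7-10)]]
  have unforced: "fem_dynamics P N h x 0 = A_fem P N h *\<^sub>v x" if "x \<in> carrier_vec (6 * N)" for x
    unfolding fem_dynamics_def zero_vec_def[symmetric] B0
    by (rule right_zero_vec[OF mult_mat_vec_carrier[OF A that]])
  have "\<exists>x\<in>carrier_vec (6 * N). \<exists>u. fem_dynamics P N h x u = y"
    if y: "y \<in> carrier_vec (6 * N)" for y
  proof -
    obtain x where x: "x \<in> carrier_vec (6 * N)" "A_fem P N h *\<^sub>v x = y"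
      using surj[OF y] by blast
    then show ?thesis using unforced[OF x(1)] by blast
  qed
  then have "brockett_condition (6 * N) (fem_dynamics P N h)"
    unfolding brockett_condition_def by (intro exI[of _ 1]) simp
  moreover have "mat_image (A_fem P N h @\<^sub>c B_fem P N) = carrier_vec (6 * N)"
  proof
    note AB = append_cols_carrier[OF A B]
    show "mat_image (A_fem P N h @\<^sub>c B_fem P N) \<subseteq> carrier_vec (6 * N)"
      unfolding mat_image_def using AB by (auto intro: mult_mat_vec_carrier)
    show "carrier_vec (6 * N) \<subseteq> mat_image (A_fem P N h @\<^sub>c B_fem P N)"
    proof
      fix y :: "real vec" assume y: "y \<in> carrier_vec (6 * N)"
      then obtain x where x: "x \<in> carrier_vec (6 * N)" "A_fem P N h *\<^sub>v x = y"
        using surj by blast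
      have "(A_fem P N h @\<^sub>c B_fem P N) *\<^sub>v (x @\<^sub>v 0\<^sub>v 1) = y"
        unfolding append_cols_mult_append_vec[OF A B x(1) zero_carrier_vec] x(2) B0
        using y by (rule right_zero_vec)
      moreover have "x @\<^sub>v 0\<^sub>v 1 \<in> carrier_vec (dim_col (A_fem P N h @\<^sub>c B_fem P N))"
        unfolding carrier_matD(2)[OF AB] by (rule append_carrier_vec[OF x(1) zero_carrier_vec])
      ultimately show "y \<in> mat_image (A_fem P N h @\<^sub>c B_fem P N)"
        unfolding mat_image_def by blast
    qed
  qed
  ultimately show ?thesis ..
qed

end
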